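(* Assume the following. (a) For every $i$: with probability $1$, $M_i(t_2,X_i)-M_i(t_1,X_i)=\int_{t_1}^{t_2}M_i'(t,X_i)\,dt$ for all intervals $(t_1,t_2)\subset\Theta$ (with endpoints in $\Theta$); moreover $\mathbf{E}M_i(\theta,X_i)=0$, $\mathbf{E}M_i^2(\theta,X_i)<\infty$, $\mathbf{E}|M_i'(\theta,X_i)|<\infty$. (b) For all sufficiently large $n$, $I_n>0$ and $J_n\neq 0$; moreover $|J_n|/\sqrt{I_n}\to\infty$, $\sum_{i=1}^n M_i'(\theta,X_i)/J_n\xrightarrow{p}1$ and $\sum_{i=1}^n M_i(\theta,X_i)/\sqrt{I_n}\Rightarrow\mathcal{N}(0,1)$. (c) $\lim_{\delta\to0}\limsup_{n\to\infty}\overline\tau_n(\delta)=0$. (d) The estimator $\theta_n^*=\theta_n^*(X_1,\dots,X_n)$ satisfies $\frac{|J_n|}{\sqrt{I_n}}|\theta_n^*-\theta|\,\overline\tau_n(|\theta_n^*-\theta|)\xrightarrow{p}0$. (e) For all $i$ the function $t\mapsto M_i(t,X_i)$ is, with probability $1$, twice differentiable, and for every $\varepsilon>0$ $$\limsup_{n\to\infty}\mathbf{P}\Big(\sum_{i=1}^n\sup_{t\in\Theta:|t-\theta|\le\delta}|M_i''(t,X_i)-M_i''(\theta,X_i)|/|J_n|>\varepsilon\Big)\to0\quad\text{as }\delta\to0;$$ moreover $\sum_{i=1}^n\big(M_i''(\theta,X_i)-\mathbf{E}M_i''(\theta,X_i)\big)/J_n\xrightarrow{p}0$. (f) $\theta_n^*$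 is consistent: $\theta_n^*\xrightarrow{p}\theta$. Let $\theta_{n,M}^{**}=\theta_n^*-\sum_{i=1}^n M_i(\theta_n^*,X_i)\big/\sum_{i=1}^n M_i'(\theta_n^*,X_i)$ and $\Delta_{n,M}=\frac{J_n}{\sqrt{I_n}}(\theta_{n,M}^{**}-\theta)+\sum_{i=1}^nM_i(\theta,X_i)/\sqrt{I_n}$. Then $$\Delta_{n,M}=\frac{J_n}{\sqrt{I_n}}(\theta_n^*-\theta)^2\Big(\frac{\sum_{i=1}^n\mathbf{E}M_i''(\theta,X_i)}{2J_n}+o_p(1)\Big)+o_p(1).$$ If in addition $\liminf_{n\to\infty}\big|\sum_{i=1}^n\mathbf{E}M_i''(\theta,X_i)\big|/|J_n|\ge\delta$ for some $\delta>0$, then the condition $\frac{|J_n|^{1/2}}{I_n^{1/4}}|\theta_n^*-\theta|\xrightarrow{p}0$ is necessary and sufficient for the convergence $\Delta_{n,M}\xrightarrow{p}0$.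
   Context: All limits are as $n\to\infty$ unless stated otherwise; $\xrightarrow{p}$ is convergence in probability, $\Rightarrow$ is weak convergence of distributions, and $o_p(1)$ denotes quantities converging to $0$ in probability. Setting: for each $n$ one observes independent elements $X_1,\dots,X_n$ of an arbitrary measurable space, not necessarily identically distributed. Their distributions depend on an unknown parameter belonging to an open set $\Theta\subset\mathbb{R}$, may also depend on $n$, and may depend on nuisance parameters. The symbol $\theta\in\Theta$ denotes the (fixed) true value, and $\mathbf{P},\mathbf{E}$ refer to the true distributions. For each $i$ there are given functions $M_i(t,X_i)$ and $M_i'(t,X_i)$ of $t\in\Theta$ (possibly depending on $n$); primes denote derivatives in the first argument. The expectations $\mathbf{E}M_i''(\theta,X_i)$ are implicitly assumed to exist and be finite. Notation: $I_n=\sum_{i=1}^n\mathbf{E}M_i^2(\theta,X_i)$, $J_n=\sum_{i=1}^n\mathbf{E}M_i'(\theta,X_i)$, $\overline\tau_n(\delta)=|J_n|^{-1}\sum_{i=1}^n\mathbf{E}\tau_i(\delta,X_i)$, where $\tau_i(\delta,X_i)=\sup_{t:|t-\theta|\le\delta}|M_i'(t,X_i)-M_i'(\theta,X_i)|$ if $[\theta-\delta,\theta+\delta]\subset\Theta$ and $\tau_i(\delta,X_i)=\infty$ otherwise. In $\overline\tau_n(|\theta_n^*-\theta|)$ the deterministic function $\overline\tau_n$ is evaluated at the random point $|\theta_n^*-\theta|$. The estimator $\theta_{n,M}^{**}$ is considered on the event (of probability tending to $1$) where it is defined. *)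

theory Defs
  imports "HOL-Probability.Probability"
begin

text \<open>
  Everything is a triangular array: \<open>P n\<close> is the true distribution of the \<open>n\<close>-th experiment,
  \<open>X n 1, \<dots>, X n n\<close> are its observations, and a family \<open>G n i t x\<close> stands for a function
  such as \<open>M\<^sub>i(t, x)\<close>, which may depend on \<open>n\<close>.
\<close>

text \<open>
  Convergence in probability along a sequence of probability spaces. The outer measure is the
  probability itself on measurable events; it is used because \<open>measure\<close> and \<open>emeasure\<close> give
  non-measurable sets the value 0, which would make the notion hold for spurious reasons
  (suprema over uncountable sets and evaluations at a random point need only be measurable
  up to null sets). The first version is for values in \<open>[0, \<infinity>]\<close>.
\<close>

definition vanishes_in_prob :: "(nat \<Rightarrow> 'a measure) \<Rightarrow> (nat \<Rightarrow> 'a \<Rightarrow> ennreal) \<Rightarrow> bool" where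
  "vanishes_in_prob P Z \<longleftrightarrow>
     (\<forall>\<epsilon>>0. (\<lambda>n. outer_measure_of (P n) {\<omega> \<in> space (P n). Z n \<omega> > ennreal \<epsilon>}) \<longlonglongrightarrow> 0)"

definition tendsto_in_prob :: "(nat \<Rightarrow> 'a measure) \<Rightarrow> (nat \<Rightarrow> 'a \<Rightarrow> real) \<Rightarrow> real \<Rightarrow> bool" where
  "tendsto_in_prob P Y c \<longleftrightarrow>
     (\<forall>\<epsilon>>0. (\<lambda>n. outer_measure_of (P n) {\<omega> \<in> space (P n). \<bar>Y n \<omega> - c\<bar> > \<epsilon>}) \<longlonglongrightarrow> 0)"

definition obs_sum ::
  "(nat \<Rightarrow> nat \<Rightarrow> 'a \<Rightarrow> 'b) \<Rightarrow> (nat \<Rightarrow> nat \<Rightarrow> real \<Rightarrow> 'b \<Rightarrow> real) \<Rightarrow> nat \<Rightarrow> real \<Rightarrow> 'a \<Rightarrow> real" where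
  "obs_sum X G n t \<omega> = (\<Sum>i=1..n. G n i t (X n i \<omega>))"

definition mean_sum ::
  "(nat \<Rightarrow> 'a measure) \<Rightarrow> (nat \<Rightarrow> nat \<Rightarrow> 'a \<Rightarrow> 'b) \<Rightarrow> (nat \<Rightarrow> nat \<Rightarrow> real \<Rightarrow> 'b \<Rightarrow> real) \<Rightarrow>
   real \<Rightarrow> nat \<Rightarrow> real" where
  "mean_sum P X G \<theta> n = (\<Sum>i=1..n. LINT \<omega>|P n. G n i \<theta> (X n i \<omega>))"

definition I_seq ::
  "(nat \<Rightarrow> 'a measure) \<Rightarrow> (nat \<Rightarrow> nat \<Rightarrow> 'a \<Rightarrow> 'b) \<Rightarrow> (nat \<Rightarrow> nat \<Rightarrow> real \<Rightarrow> 'b \<Rightarrow> real) \<Rightarrow>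
   real \<Rightarrow> nat \<Rightarrow> real" where
  "I_seq P X M \<theta> n = (\<Sum>i=1..n. LINT \<omega>|P n. (M n i \<theta> (X n i \<omega>))\<^sup>2)"

text \<open>In \<open>J_seq\<close>, \<open>tau\<close> and \<open>tau_bar\<close> the argument \<open>M'\<close> is the derivative of \<open>M\<close> in \<open>t\<close>.\<close>

definition J_seq ::
  "(nat \<Rightarrow> 'a measure) \<Rightarrow> (nat \<Rightarrow> nat \<Rightarrow> 'a \<Rightarrow> 'b) \<Rightarrow> (nat \<Rightarrow> nat \<Rightarrow> real \<Rightarrow> 'b \<Rightarrow> real) \<Rightarrow>
   real \<Rightarrow> nat \<Rightarrow> real" where
  "J_seq P X M' \<theta> n = mean_sum P X M' \<theta> n"

definition tau ::
  "real set \<Rightarrow> real \<Rightarrow> (nat \<Rightarrow> nat \<Rightarrow> real \<Rightarrow> 'b \<Rightarrow> real) \<Rightarrow> nat \<Rightarrow> nat \<Rightarrow> real \<Rightarrow> 'b \<Rightarrow> ennreal" where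
  "tau \<Theta> \<theta> M' n i \<delta> x =
     (if {\<theta> - \<delta>..\<theta> + \<delta>} \<subseteq> \<Theta>
      then SUP t\<in>{t. \<bar>t - \<theta>\<bar> \<le> \<delta>}. ennreal \<bar>M' n i t x - M' n i \<theta> x\<bar>
      else \<infinity>)"

definition tau_bar ::
  "(nat \<Rightarrow> 'a measure) \<Rightarrow> (nat \<Rightarrow> nat \<Rightarrow> 'a \<Rightarrow> 'b) \<Rightarrow> real set \<Rightarrow> real \<Rightarrow>
   (nat \<Rightarrow> nat \<Rightarrow> real \<Rightarrow> 'b \<Rightarrow> real) \<Rightarrow> nat \<Rightarrow> real \<Rightarrow> ennreal" where
  "tau_bar P X \<Theta> \<theta> M' n \<delta> =
     (\<Sum>i=1..n. \<integral>\<^sup>+\<omega>. tau \<Theta> \<theta> M' n i \<delta> (X n i \<omega>) \<partial>P n) / ennreal \<bar>J_seq P X M' \<theta> n\<bar>"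

text \<open>A statistic is a function of the data \<open>(X\<^sub>1, \<dots>, X\<^sub>n)\<close>, taken as an element of the
  product over \<open>{1..n}\<close>.\<close>

definition statistic ::
  "(nat \<Rightarrow> nat \<Rightarrow> 'a \<Rightarrow> 'b) \<Rightarrow> (nat \<Rightarrow> (nat \<Rightarrow> 'b) \<Rightarrow> real) \<Rightarrow> nat \<Rightarrow> 'a \<Rightarrow> real" where
  "statistic X est n \<omega> = est n (\<lambda>i\<in>{1..n}. X n i \<omega>)"

text \<open>The event on which the one-step estimator \<open>\<theta>\<^sup>*\<^sup>*\<close> is defined, given the preliminary
  estimator \<open>T\<close>. Off this event \<open>one_step\<close> has an arbitrary value.\<close>

definition one_step_defined ::
  "(nat \<Rightarrow> 'a measure) \<Rightarrow> (nat \<Rightarrow> nat \<Rightarrow> 'a \<Rightarrow> 'b) \<Rightarrow> real set \<Rightarrow>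
   (nat \<Rightarrow> nat \<Rightarrow> real \<Rightarrow> 'b \<Rightarrow> real) \<Rightarrow> (nat \<Rightarrow> 'a \<Rightarrow> real) \<Rightarrow> nat \<Rightarrow> 'a set" where
  "one_step_defined P X \<Theta> M' T n =
     {\<omega> \<in> space (P n). T n \<omega> \<in> \<Theta> \<and> obs_sum X M' n (T n \<omega>) \<omega> \<noteq> 0}"

definition one_step ::
  "(nat \<Rightarrow> nat \<Rightarrow> 'a \<Rightarrow> 'b) \<Rightarrow> (nat \<Rightarrow> nat \<Rightarrow> real \<Rightarrow> 'b \<Rightarrow> real) \<Rightarrow>
   (nat \<Rightarrow> nat \<Rightarrow> real \<Rightarrow> 'b \<Rightarrow> real) \<Rightarrow> (nat \<Rightarrow> 'a \<Rightarrow> real) \<Rightarrow> nat \<Rightarrow> 'a \<Rightarrow> real" where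
  "one_step X M M' T n \<omega> =
     T n \<omega> - obs_sum X M n (T n \<omega>) \<omega> / obs_sum X M' n (T n \<omega>) \<omega>"

definition Delta ::
  "(nat \<Rightarrow> 'a measure) \<Rightarrow> (nat \<Rightarrow> nat \<Rightarrow> 'a \<Rightarrow> 'b) \<Rightarrow> real \<Rightarrow>
   (nat \<Rightarrow> nat \<Rightarrow> real \<Rightarrow> 'b \<Rightarrow> real) \<Rightarrow> (nat \<Rightarrow> nat \<Rightarrow> real \<Rightarrow> 'b \<Rightarrow> real) \<Rightarrow>
   (nat \<Rightarrow> 'a \<Rightarrow> real) \<Rightarrow> nat \<Rightarrow> 'a \<Rightarrow> real" where
  "Delta P X \<theta> M M' T n \<omega> =
     J_seq P X M' \<theta> n / sqrt (I_seq P X M \<theta> n) * (one_step X M M' T n \<omega> - \<theta>)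
     + obs_sum X M n \<theta> \<omega> / sqrt (I_seq P X M \<theta> n)"

end

theory Submission
  imports Defs
begin

text \<open>
  Write \<open>S(t) = \<Sum>\<^sub>i M\<^sub>i(t, X\<^sub>i)\<close>, \<open>u = T - \<theta>\<close>, \<open>V = S'(T) / J\<close>, \<open>A = S(\<theta>) / \<surd>I\<close> and
  \<open>W = (u S'(T) - S(T) + S(\<theta>)) / (J u\<^sup>2)\<close>. Wherever the one-step estimator is defined,
  \<open>\<Delta> = (J / \<surd>I) u\<^sup>2 W / V + A (1 - 1 / V)\<close> holds exactly. By Taylor's theorem at \<open>T\<close>,
  \<open>W = S''(\<xi>) / (2 J)\<close> with \<open>\<xi>\<close> between \<open>\<theta>\<close> and \<open>T\<close>, and this is \<open>K / (2 J) + o\<^sub>p(1)\<close> by (e)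
  and (f). By (c), \<open>S'\<close> changes by at most a multiple of \<open>J\<close> on a fixed interval
  \<open>[\<theta>, \<theta> + \<delta>]\<close>, which by (e) forces \<open>K / J\<close> to be bounded; hence \<open>V \<rightarrow> 1\<close> in probability. As \<open>A\<close>
  is bounded in probability, the expansion follows, with the explicit remainders
  \<open>r\<^sub>1 = W / V - K / (2 J)\<close> and \<open>r\<^sub>2 = A (1 - 1 / V)\<close>.
\<close>

section \<open>Events whose outer probability tends to zero\<close>

text \<open>Events are handled as predicates in \<open>n\<close> and \<open>\<omega>\<close>, so
  that inclusions between them become implications checked pointwise. Outer measure is used because
  events that ask for some \<open>t \<in> \<Theta>\<close> need not be measurable.\<close>

definition vanishing_event :: "(nat \<Rightarrow> 'a measure) \<Rightarrow> (nat \<Rightarrow> 'a \<Rightarrow> bool) \<Rightarrow> bool" where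
  "vanishing_event P Q \<longleftrightarrow>
     (\<lambda>n. outer_measure_of (P n) {\<omega> \<in> space (P n). Q n \<omega>}) \<longlonglongrightarrow> 0"

lemma tendsto_in_prob_iff_vanishing:
  "tendsto_in_prob P Y c \<longleftrightarrow> (\<forall>\<epsilon>>0. vanishing_event P (\<lambda>n \<omega>. \<bar>Y n \<omega> - c\<bar> > \<epsilon>))"
  by (simp add: tendsto_in_prob_def vanishing_event_def)

lemma tendsto_in_probD:
  assumes "tendsto_in_prob P Y c" "\<epsilon> > 0"
  shows "vanishing_event P (\<lambda>n \<omega>. \<bar>Y n \<omega> - c\<bar> > \<epsilon>)"
  using assms by (simp add: tendsto_in_prob_iff_vanishing)

text \<open>Each of the two sets has a measurable cover of the same measure, and the union of the
  covers contains the disjunction.\<close>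

lemma outer_measure_of_disj_le:
  "outer_measure_of M {\<omega> \<in> space M. Q \<omega> \<or> R \<omega>}
     \<le> outer_measure_of M {\<omega> \<in> space M. Q \<omega>} + outer_measure_of M {\<omega> \<in> space M. R \<omega>}"
proof -
  obtain A where A: "A \<in> sets M" "{\<omega> \<in> space M. Q \<omega>} \<subseteq> A"
    "outer_measure_of M {\<omega> \<in> space M. Q \<omega>} = emeasure M A"
    using outer_measure_of_attain[of "{\<omega> \<in> space M. Q \<omega>}" M] by blast
  obtain B where B: "B \<in> sets M" "{\<omega> \<in> space M. R \<omega>} \<subseteq> B"
    "outer_measure_of M {\<omega> \<in> space M. R \<omega>} = emeasure M B"
    using outer_measure_of_attain[of "{\<omega> \<in> space M. R \<omega>}" M] by blast
  have "outer_measure_of M {\<omega> \<in> space M. Q \<omega> \<or> R \<omega>} \<le> outer_measure_of M (A \<union> B)"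
    using A(2) B(2) by (intro outer_measure_of_mono) blast
  also have "\<dots> \<le> emeasure M A + emeasure M B"
    using A(1) B(1) by (simp add: emeasure_subadditive)
  finally show ?thesis using A(3) B(3) by simp
qed

lemma outer_measure_of_AE_eq_0:
  assumes "AE \<omega> in M. \<not> Q \<omega>"
  shows "outer_measure_of M {\<omega> \<in> space M. Q \<omega>} = 0"
proof -
  obtain N where N: "N \<in> sets M" "emeasure M N = 0" "{\<omega> \<in> space M. \<not> \<not> Q \<omega>} \<subseteq> N"
    using AE_E[OF assms] by metis
  have "outer_measure_of M {\<omega> \<in> space M. Q \<omega>} \<le> outer_measure_of M N"
    using N(3) by (intro outer_measure_of_mono) auto
  then show ?thesis using N by simp
qed

text \<open>Turns a probability estimate into a sample point; this is what lets random constraints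
  bound the deterministic ratio \<open>K n / J n\<close>.\<close>

lemma (in prob_space) exists_if_outer_measure_lt_1:
  assumes "outer_measure_of M {\<omega> \<in> space M. Q \<omega>} < 1"
  shows "\<exists>\<omega>\<in>space M. \<not> Q \<omega>"
proof (rule ccontr)
  assume "\<not> ?thesis"
  then have "{\<omega> \<in> space M. Q \<omega>} = space M" by auto
  then show False using assms by (simp add: emeasure_space_1)
qed

lemma vanishing_event_mono:
  assumes "vanishing_event P R"
    and "\<forall>\<^sub>F n in sequentially. \<forall>\<omega>\<in>space (P n). Q n \<omega> \<longrightarrow> R n \<omega>"
  shows "vanishing_event P Q"
  unfolding vanishing_event_def
proof (rule tendsto_sandwich[OF _ _ tendsto_const assms(1)[unfolded vanishing_event_def]])
  show "\<forall>\<^sub>F n in sequentially. outer_measure_of (P n) {\<omega> \<in> space (P n). Q n \<omega>}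
          \<le> outer_measure_of (P n) {\<omega> \<in> space (P n). R n \<omega>}"
    using assms(2) by eventually_elim (auto intro!: outer_measure_of_mono)
qed simp

lemma vanishing_event_disj:
  assumes "vanishing_event P Q" "vanishing_event P R"
  shows "vanishing_event P (\<lambda>n \<omega>. Q n \<omega> \<or> R n \<omega>)"
  unfolding vanishing_event_def
proof (rule tendsto_sandwich[OF _ _ tendsto_const])
  show "(\<lambda>n. outer_measure_of (P n) {\<omega> \<in> space (P n). Q n \<omega>}
           + outer_measure_of (P n) {\<omega> \<in> space (P n). R n \<omega>}) \<longlonglongrightarrow> 0"
    using tendsto_add[OF assms[unfolded vanishing_event_def]] by simp
qed (auto intro!: always_eventually outer_measure_of_disj_le)

lemma vanishing_event_AE:
  assumes "\<And>n. AE \<omega> in P n. \<not> Q n \<omega>"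
  shows "vanishing_event P Q"
  unfolding vanishing_event_def by (simp add: outer_measure_of_AE_eq_0[OF assms])

lemma vanishing_eventD:
  assumes "vanishing_event P Q" "0 < \<eta>"
  shows "\<forall>\<^sub>F n in sequentially. outer_measure_of (P n) {\<omega> \<in> space (P n). Q n \<omega>} < ennreal \<eta>"
  using order_tendstoD(2)[OF assms(1)[unfolded vanishing_event_def], of "ennreal \<eta>"] assms(2)
  by simp

text \<open>Serves events that can be controlled only up to a tolerance: \<open>R'\<close> is merely
  required to be eventually below \<open>\<eta>\<close>, which is all that a fixed radius in (e) or
  a tail of a tight sequence provides.\<close>

lemma vanishing_event_approx:
  assumes "\<And>\<eta>. \<eta> > 0 \<Longrightarrow> \<exists>R R'. vanishing_event P R \<and>
      (\<forall>\<^sub>F n in sequentially. outer_measure_of (P n) {\<omega> \<in> space (P n). R' n \<omega>} < ennreal \<eta>) \<and>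
      (\<forall>\<^sub>F n in sequentially. \<forall>\<omega>\<in>space (P n). Q n \<omega> \<longrightarrow> R n \<omega> \<or> R' n \<omega>)"
  shows "vanishing_event P Q"
  unfolding vanishing_event_def
proof (rule order_tendstoI)
  fix a :: ennreal assume "0 < a"
  \<comment> \<open>Anything strictly below \<open>a\<close> is finite, even if
    \<open>a = top\<close>, and is therefore a real number that can be halved.\<close>
  then obtain b where b: "0 < b" "b < a" using dense by blast
  define e where "e = enn2real b"
  have "b < top" using b(2) by (meson order_less_le_trans top_greatest)
  then have e: "b = ennreal e" "0 < e" using b by (auto simp: e_def enn2real_positive_iff)
  obtain R R' where R: "vanishing_event P R"
    and R': "\<forall>\<^sub>F n in sequentially. outer_measure_of (P n) {\<omega> \<in> space (P n). R' n \<omega>} < ennreal (e/2)"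
    and sub: "\<forall>\<^sub>F n in sequentially. \<forall>\<omega>\<in>space (P n). Q n \<omega> \<longrightarrow> R n \<omega> \<or> R' n \<omega>"
    using assms[of "e/2"] e by auto
  have "\<forall>\<^sub>F n in sequentially. outer_measure_of (P n) {\<omega> \<in> space (P n). R n \<omega>} < ennreal (e/2)"
    using vanishing_eventD[OF R, of "e/2"] e by simp
  then show "\<forall>\<^sub>F n in sequentially. outer_measure_of (P n) {\<omega> \<in> space (P n). Q n \<omega>} < a"
    using R' sub
  proof eventually_elim
    case (elim n)
    have "outer_measure_of (P n) {\<omega> \<in> space (P n). Q n \<omega>}
      \<le> outer_measure_of (P n) {\<omega> \<in> space (P n). R n \<omega> \<or> R' n \<omega>}"
      using elim(3) by (intro outer_measure_of_mono) auto
    also have "\<dots> \<le> ennreal (e/2) + ennreal (e/2)"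
      using elim(1,2) by (intro order_trans[OF outer_measure_of_disj_le] add_mono) auto
    also have "\<dots> = b" using e by (simp flip: ennreal_plus)
    finally show ?case using b by simp
  qed
qed simp

section \<open>Boundedness in probability from weak convergence\<close>

text \<open>The limit cdf is continuous everywhere, so the cdfs converge both at \<open>C\<close>
  and at \<open>-C\<close>, where \<open>C\<close> is chosen to leave limit mass below
  \<open>\<eta>/2\<close> in each tail.\<close>

lemma weak_conv_m_imp_bounded_in_prob:
  assumes prob: "\<And>n. prob_space (P n)"
    and A: "\<And>n. A n \<in> borel_measurable (P n)"
    and conv: "weak_conv_m (\<lambda>n. distr (P n) borel (A n)) N"
    and N: "real_distribution N" "\<And>x. isCont (cdf N) x"
    and "\<eta> > 0"
  shows "\<exists>C>0. \<forall>\<^sub>F n in sequentially.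
           outer_measure_of (P n) {\<omega> \<in> space (P n). \<bar>A n \<omega>\<bar> > C} < ennreal \<eta>"
proof -
  interpret N: real_distribution N by fact
  have "\<forall>\<^sub>F x in at_top. cdf N x > 1 - \<eta>/2"
    using order_tendstoD(1)[OF N.cdf_lim_at_top_prob] \<open>\<eta> > 0\<close> by simp
  moreover have "\<forall>\<^sub>F x in at_top. cdf N (-x) < \<eta>/2"
    using order_tendstoD(2)[OF N.cdf_lim_at_bot, of "\<eta>/2"] \<open>\<eta> > 0\<close>
    by (simp add: at_bot_mirror eventually_filtermap)
  ultimately have "\<forall>\<^sub>F x::real in at_top. 1 - \<eta>/2 < cdf N x \<and> cdf N (-x) < \<eta>/2 \<and> x > 0"
    using eventually_gt_at_top[of 0] by eventually_elim auto
  then obtain C where C: "1 - \<eta>/2 < cdf N C" "cdf N (-C) < \<eta>/2" "C > 0"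
    by (auto simp: eventually_at_top_linorder)
  define F where "F n x = measure (P n) {\<omega> \<in> space (P n). A n \<omega> \<le> x}" for n x
  have F: "cdf (distr (P n) borel (A n)) = F n" for n
    using A[of n] by (auto simp: cdf_def F_def measure_distr vimage_def Int_def intro!: ext arg_cong[where f="measure _"])
  have lim: "(\<lambda>n. F n x) \<longlonglongrightarrow> cdf N x" for x
    using conv N(2) by (simp add: weak_conv_m_def weak_conv_def F)
  have "\<forall>\<^sub>F n in sequentially. F n (-C) < \<eta>/2" "\<forall>\<^sub>F n in sequentially. F n C > 1 - \<eta>/2"
    using order_tendstoD(2)[OF lim C(2)] order_tendstoD(1)[OF lim C(1)] by auto
  then have "\<forall>\<^sub>F n in sequentially.
      outer_measure_of (P n) {\<omega> \<in> space (P n). \<bar>A n \<omega>\<bar> > C} < ennreal \<eta>"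
  proof eventually_elim
    case (elim n)
    interpret prob_space "P n" by (rule prob)
    note [measurable] = A[of n]
    have "{\<omega> \<in> space (P n). \<bar>A n \<omega>\<bar> > C} \<subseteq>
        {\<omega> \<in> space (P n). A n \<omega> \<le> -C} \<union> {\<omega> \<in> space (P n). \<not> A n \<omega> \<le> C}" by auto
    then have "prob {\<omega> \<in> space (P n). \<bar>A n \<omega>\<bar> > C} \<le>
       prob ({\<omega> \<in> space (P n). A n \<omega> \<le> -C} \<union> {\<omega> \<in> space (P n). \<not> A n \<omega> \<le> C})"
      by (rule finite_measure_mono) measurable
    also have "\<dots> \<le> F n (-C) + prob {\<omega> \<in> space (P n). \<not> A n \<omega> \<le> C}"
      unfolding F_def by (rule measure_Un_le) measurable
    also have "prob {\<omega> \<in> space (P n). \<not> A n \<omega> \<le> C} = 1 - F n C"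
      unfolding F_def by (rule prob_neg) measurable
    finally have "prob {\<omega> \<in> space (P n). \<bar>A n \<omega>\<bar> > C} < \<eta>" using elim by simp
    then show ?case by (simp add: emeasure_eq_measure ennreal_lessI \<open>\<eta> > 0\<close>)
  qed
  with C(3) show ?thesis by blast
qed

text \<open>A cdf jumps only at atoms, and single points are Lebesgue null.\<close>

lemma isCont_cdf_std_normal: "isCont (cdf std_normal_distribution) x"
proof -
  interpret real_distribution std_normal_distribution by (rule real_dist_normal_dist)
  have "emeasure std_normal_distribution {x} = 0"
    by (subst emeasure_density)
       (auto intro!: nn_integral_null_set simp: null_sets_def)
  then show ?thesis by (simp add: isCont_cdf measure_def)
qed

section \<open>Taylor expansion around the estimator\<close>

text \<open>Both bounds come from expanding at \<open>T\<close> with Lagrange remainder, because the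
  Newton step linearises at \<open>T\<close>: \<open>F'\<close> to first order, then
  \<open>F\<close> to second order. In use, \<open>j\<close> is \<open>J n\<close> and
  \<open>k\<close> is \<open>K n / J n\<close>.\<close>

lemma second_order_expansion:
  fixes F F' F'' :: "real \<Rightarrow> real"
  assumes F: "\<And>s. \<bar>s - t\<bar> \<le> \<bar>T - t\<bar> \<Longrightarrow> (F has_real_derivative F' s) (at s)"
    and F': "\<And>s. \<bar>s - t\<bar> \<le> \<bar>T - t\<bar> \<Longrightarrow> (F' has_real_derivative F'' s) (at s)"
    and F'': "\<And>s. \<bar>s - t\<bar> \<le> \<bar>T - t\<bar> \<Longrightarrow> \<bar>F'' s / j - k\<bar> \<le> e"
    and j: "j \<noteq> 0"
  shows "\<bar>F' T / j - F' t / j\<bar> \<le> \<bar>T - t\<bar> * (\<bar>k\<bar> + e)"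
    and "T \<noteq> t \<Longrightarrow> \<bar>((T - t) * F' T - F T + F t) / (j * (T - t)\<^sup>2) - k / 2\<bar> \<le> e / 2"
proof -
  have expand: "\<exists>s. \<bar>s - t\<bar> \<le> \<bar>T - t\<bar> \<and> F' t = F' T + F'' s * (t - T)" if "T \<noteq> t"
  proof -
    \<comment> \<open>\<open>diff\<close> lists the successive derivatives of the function that is
      expanded, here \<open>F'\<close>; the endpoints \<open>min t T\<close> and
      \<open>max t T\<close> cover both orders of the two points.\<close>
    define diff where "diff m = (if m = 0 then F' else F'')" for m :: nat
    have "\<exists>s. (if t < T then t < s \<and> s < T else T < s \<and> s < t) \<and>
        F' t = (\<Sum>m<1. (diff m T / fact m) * (t - T)^m) + (diff 1 s / fact 1) * (t - T)^1"
      by (rule Taylor[where a="min t T" and b="max t T"]) (use that F' in \<open>auto simp: diff_def\<close>)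
    then obtain s where s: "if t < T then t < s \<and> s < T else T < s \<and> s < t"
      "F' t = F' T + F'' s * (t - T)" by (auto simp: diff_def)
    then have "\<bar>s - t\<bar> \<le> \<bar>T - t\<bar>" by (auto split: if_splits)
    with s(2) show ?thesis by blast
  qed
  show "\<bar>F' T / j - F' t / j\<bar> \<le> \<bar>T - t\<bar> * (\<bar>k\<bar> + e)"
  proof (cases "T = t")
    case False
    then obtain s where s: "\<bar>s - t\<bar> \<le> \<bar>T - t\<bar>" "F' t = F' T + F'' s * (t - T)"
      using expand by blast
    have "F' T / j - F' t / j = (T - t) * (F'' s / j)" using s(2) j by (simp add: field_simps)
    moreover have "\<bar>F'' s / j\<bar> \<le> \<bar>k\<bar> + e" using F''[OF s(1)] by linarith
    ultimately show ?thesis by (simp only: abs_mult mult_left_mono abs_ge_zero)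
  qed simp
  assume "T \<noteq> t"
  define diff where "diff m = (if m = 0 then F else if m = 1 then F' else F'')" for m :: nat
  have "\<exists>s. (if t < T then t < s \<and> s < T else T < s \<and> s < t) \<and>
      F t = (\<Sum>m<2. (diff m T / fact m) * (t - T)^m) + (diff 2 s / fact 2) * (t - T)^2"
    by (rule Taylor[where a="min t T" and b="max t T"])
       (use \<open>T \<noteq> t\<close> F F' in \<open>auto simp: diff_def less_2_cases_iff\<close>)
  then obtain s where between: "if t < T then t < s \<and> s < T else T < s \<and> s < t"
    and "F t = F T + F' T * (t - T) + F'' s / 2 * (t - T)\<^sup>2"
    by (auto simp: diff_def numeral_2_eq_2)
  moreover have s: "\<bar>s - t\<bar> \<le> \<bar>T - t\<bar>" using between by (auto split: if_splits)
  ultimately have "(T - t) * F' T - F T + F t = F'' s / 2 * (T - t)\<^sup>2"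
    by (simp add: algebra_simps power2_commute)
  then have "((T - t) * F' T - F T + F t) / (j * (T - t)\<^sup>2) = (F'' s / j) / 2"
    using \<open>T \<noteq> t\<close> j by (simp add: field_simps)
  then have eq: "((T - t) * F' T - F T + F t) / (j * (T - t)\<^sup>2) - k / 2 = (F'' s / j - k) / 2"
    by (simp add: diff_divide_distrib)
  show "\<bar>((T - t) * F' T - F T + F t) / (j * (T - t)\<^sup>2) - k / 2\<bar> \<le> e / 2"
    unfolding eq using F''[OF s] by (simp add: abs_divide divide_right_mono del: divide_le_cancel)
qed

section \<open>Sums over the observations\<close>

lemma obs_sum_has_derivative:
  assumes "\<And>i. i \<in> {1..n} \<Longrightarrow>
    ((\<lambda>s. G n i s (X n i \<omega>)) has_real_derivative G' n i t (X n i \<omega>)) (at t)"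
  shows "((\<lambda>s. obs_sum X G n s \<omega>) has_real_derivative obs_sum X G' n t \<omega>) (at t)"
  unfolding obs_sum_def by (rule DERIV_sum) (use assms in auto)

lemma obs_sum_measurable:
  assumes "\<And>i. i \<in> {1..n} \<Longrightarrow> X n i \<in> measurable N R"
    and "\<And>i. i \<in> {1..n} \<Longrightarrow> G n i t \<in> borel_measurable R"
  shows "obs_sum X G n t \<in> borel_measurable N"
  unfolding obs_sum_def[abs_def]
  by (intro borel_measurable_sum measurable_compose[OF assms(1) assms(2)])

lemma ennreal_abs_sum_divide_le:
  fixes a :: "'i \<Rightarrow> real"
  assumes "j \<noteq> 0"
  shows "ennreal \<bar>(\<Sum>i\<in>A. a i) / j\<bar> \<le> (\<Sum>i\<in>A. ennreal \<bar>a i\<bar> / ennreal \<bar>j\<bar>)"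
proof -
  have "ennreal \<bar>(\<Sum>i\<in>A. a i) / j\<bar> \<le> ennreal (\<Sum>i\<in>A. \<bar>a i\<bar> / \<bar>j\<bar>)"
    by (auto simp: sum_divide_distrib[symmetric] abs_divide intro!: ennreal_leI divide_right_mono)
  also have "\<dots> = (\<Sum>i\<in>A. ennreal \<bar>a i\<bar> / ennreal \<bar>j\<bar>)"
    using assms by (simp add: divide_ennreal flip: sum_ennreal)
  finally show ?thesis .
qed

text \<open>A sum of suprema dominates the sum at any single \<open>t\<close>. The right-hand side
  has exactly the shape of the modulus in (e).\<close>

lemma obs_sum_diff_le_SUP:
  assumes "j \<noteq> 0" "t \<in> A"
  shows "ennreal \<bar>obs_sum X G n t \<omega> / j - obs_sum X G n \<theta> \<omega> / j\<bar>
    \<le> (\<Sum>i=1..n. (SUP t\<in>A. ennreal \<bar>G n i t (X n i \<omega>) - G n i \<theta> (X n i \<omega>)\<bar>) / ennreal \<bar>j\<bar>)"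
proof -
  have "obs_sum X G n t \<omega> / j - obs_sum X G n \<theta> \<omega> / j
    = (\<Sum>i=1..n. G n i t (X n i \<omega>) - G n i \<theta> (X n i \<omega>)) / j"
    by (simp add: obs_sum_def sum_subtractf diff_divide_distrib)
  also have "ennreal \<bar>\<dots>\<bar> \<le> (\<Sum>i=1..n. ennreal \<bar>G n i t (X n i \<omega>) - G n i \<theta> (X n i \<omega>)\<bar> / ennreal \<bar>j\<bar>)"
    by (rule ennreal_abs_sum_divide_le) fact
  also have "\<dots> \<le> (\<Sum>i=1..n. (SUP t\<in>A. ennreal \<bar>G n i t (X n i \<omega>) - G n i \<theta> (X n i \<omega>)\<bar>) / ennreal \<bar>j\<bar>)"
    by (intro sum_mono divide_right_mono_ennreal SUP_upper assms)
  finally show ?thesis .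
qed

text \<open>At one fixed \<open>t\<close> the summands are measurable, so the integral of the sum
  splits. \<open>tau\<close> enters only through monotonicity of the integral, and where it is
  infinite the bound is trivial.\<close>

lemma nn_integral_obs_sum_diff_le_tau_bar:
  fixes P :: "nat \<Rightarrow> 'a measure" and n :: nat and t :: real
  assumes X: "\<And>i. i \<in> {1..n} \<Longrightarrow> X n i \<in> measurable (P n) (S n)"
    and G: "\<And>i t. i \<in> {1..n} \<Longrightarrow> t \<in> \<Theta> \<Longrightarrow> G n i t \<in> borel_measurable (S n)"
    and j: "J_seq P X G \<theta> n \<noteq> 0"
    and t: "t \<in> \<Theta>" "\<theta> \<in> \<Theta>" "\<bar>t - \<theta>\<bar> \<le> \<delta>"
  shows "(\<integral>\<^sup>+\<omega>. ennreal \<bar>obs_sum X G n t \<omega> / J_seq P X G \<theta> n - obs_sum X G n \<theta> \<omega> / J_seq P X G \<theta> n\<bar> \<partial>P n)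
    \<le> tau_bar P X \<Theta> \<theta> G n \<delta>"
proof -
  let ?j = "J_seq P X G \<theta> n"
  let ?a = "\<lambda>i \<omega>. ennreal \<bar>G n i t (X n i \<omega>) - G n i \<theta> (X n i \<omega>)\<bar>"
  have meas: "?a i \<in> borel_measurable (P n)" if "i \<in> {1..n}" for i
    using measurable_compose[OF X[OF that] G[OF that t(1)]] measurable_compose[OF X[OF that] G[OF that t(2)]]
    by measurable
  have "\<bar>obs_sum X G n t \<omega> / ?j - obs_sum X G n \<theta> \<omega> / ?j\<bar>
     = \<bar>(\<Sum>i=1..n. G n i t (X n i \<omega>) - G n i \<theta> (X n i \<omega>)) / ?j\<bar>" for \<omega>
    by (simp add: obs_sum_def sum_subtractf diff_divide_distrib)
  then have "(\<integral>\<^sup>+\<omega>. ennreal \<bar>obs_sum X G n t \<omega> / ?j - obs_sum X G n \<theta> \<omega> / ?j\<bar> \<partial>P n)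
    \<le> (\<integral>\<^sup>+\<omega>. (\<Sum>i=1..n. ?a i \<omega> / ennreal \<bar>?j\<bar>) \<partial>P n)"
    by (simp only:) (intro nn_integral_mono ennreal_abs_sum_divide_le j)
  also have "\<dots> = (\<Sum>i=1..n. (\<integral>\<^sup>+\<omega>. ?a i \<omega> \<partial>P n)) / ennreal \<bar>?j\<bar>"
    unfolding divide_ennreal_def sum_distrib_right
    by (subst nn_integral_sum) (use meas in \<open>auto intro!: sum.cong nn_integral_multc\<close>)
  also have "\<dots> \<le> tau_bar P X \<Theta> \<theta> G n \<delta>"
    unfolding tau_bar_def
    by (intro divide_right_mono_ennreal sum_mono nn_integral_mono)
       (use t(3) in \<open>auto simp: tau_def intro!: SUP_upper\<close>)
  finally show ?thesis .
qed

section \<open>Algebra of the one-step estimator\<close>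

text \<open>Here \<open>j\<close>, \<open>s\<close>, \<open>u\<close> are \<open>J\<close>, the root
  of \<open>I\<close> and \<open>T - \<theta>\<close>; \<open>m\<close>, \<open>m0\<close>,
  \<open>d\<close> are the score at \<open>T\<close>, the score at \<open>\<theta>\<close> and its
  derivative at \<open>T\<close>; \<open>c\<close> is \<open>K / (2 J)\<close>. For
  \<open>u \<noteq> 0\<close> the centring \<open>c\<close> cancels; for \<open>u = 0\<close> the
  quadratic term disappears and \<open>m = m0\<close> closes the gap.\<close>

lemma one_step_identity:
  fixes u :: real
  assumes "j \<noteq> 0" "d \<noteq> 0" "u = 0 \<Longrightarrow> m = m0"
  shows "j / s * (u - m / d) + m0 / s =
    j / s * u\<^sup>2 * (c + (if u = 0 then 0 else (u * d - m + m0) / (j * u\<^sup>2) / (d / j) - c))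
      + m0 / s * (1 - 1 / (d / j))"
  \<comment> \<open>If \<open>s = 0\<close>, all quotients by \<open>s\<close> are 0 and both sides
    vanish.\<close>
  using assms by (cases "s = 0") (auto simp: field_simps power2_eq_square)

text \<open>Inversion is Lipschitz near 1, since \<open>v \<ge> 1/2\<close> here. This carries
  closeness of \<open>V\<close> to 1 over to \<open>1 / V\<close> and is the source of the cap 1/2
  on \<open>\<kappa>\<close> in the main proof.\<close>

lemma abs_one_minus_inverse_le:
  fixes v :: real
  assumes "\<bar>v - 1\<bar> \<le> 1/2"
  shows "\<bar>1 - 1 / v\<bar> \<le> 2 * \<bar>v - 1\<bar>" "\<bar>1 / v\<bar> \<le> 2"
proof -
  have v: "v \<ge> 1/2" using assms by linarith
  then show 2: "\<bar>1 / v\<bar> \<le> 2" by (simp add: field_simps)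
  have "1 - 1 / v = (v - 1) * (1 / v)" using v by (simp add: field_simps)
  then have "\<bar>1 - 1 / v\<bar> = \<bar>v - 1\<bar> * \<bar>1 / v\<bar>" by (simp add: abs_mult)
  also have "\<dots> \<le> \<bar>v - 1\<bar> * 2" using 2 by (intro mult_left_mono) auto
  finally show "\<bar>1 - 1 / v\<bar> \<le> 2 * \<bar>v - 1\<bar>" by simp
qed

theorem mainTheorem3:
  fixes P :: "nat \<Rightarrow> 'a measure"
    and S :: "nat \<Rightarrow> 'b measure"
    and X :: "nat \<Rightarrow> nat \<Rightarrow> 'a \<Rightarrow> 'b"
    and \<Theta> :: "real set" and \<theta> :: real
    and M M' M'' :: "nat \<Rightarrow> nat \<Rightarrow> real \<Rightarrow> 'b \<Rightarrow> real"
    and est :: "nat \<Rightarrow> (nat \<Rightarrow> 'b) \<Rightarrow> real"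
    and I J K :: "nat \<Rightarrow> real"
    and T \<Delta> :: "nat \<Rightarrow> 'a \<Rightarrow> real"
  defines "I \<equiv> I_seq P X M \<theta>"
    and "J \<equiv> J_seq P X M' \<theta>"
    and "K \<equiv> mean_sum P X M'' \<theta>"
    and "T \<equiv> statistic X est"
    and "\<Delta> \<equiv> Delta P X \<theta> M M' T"
  assumes prob: "\<And>n. prob_space (P n)"
    and indep: "\<And>n. prob_space.indep_vars (P n) (\<lambda>_. S n) (X n) {1..n}"
    and Theta: "open \<Theta>" "\<theta> \<in> \<Theta>"
    and meas_M: "\<And>n i t. i \<in> {1..n} \<Longrightarrow> t \<in> \<Theta> \<Longrightarrow> M n i t \<in> borel_measurable (S n)"
    and meas_M': "\<And>n i t. i \<in> {1..n} \<Longrightarrow> t \<in> \<Theta> \<Longrightarrow> M' n i t \<in> borel_measurable (S n)"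
    and meas_est: "\<And>n. est n \<in> borel_measurable (PiM {1..n} (\<lambda>_. S n))"
    and M''_integrable:
      "\<And>n i. i \<in> {1..n} \<Longrightarrow> integrable (P n) (\<lambda>\<omega>. M'' n i \<theta> (X n i \<omega>))"
    and a_integral: "\<And>n i. i \<in> {1..n} \<Longrightarrow>
      AE \<omega> in P n. \<forall>t1 t2. t1 < t2 \<longrightarrow> {t1..t2} \<subseteq> \<Theta> \<longrightarrow>
        set_integrable lborel {t1..t2} (\<lambda>t. M' n i t (X n i \<omega>)) \<and>
        M n i t2 (X n i \<omega>) - M n i t1 (X n i \<omega>) = (LINT t:{t1..t2}|lborel. M' n i t (X n i \<omega>))"
    and a_mean: "\<And>n i. i \<in> {1..n} \<Longrightarrow> (LINT \<omega>|P n. M n i \<theta> (X n i \<omega>)) = 0"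
    and a_square: "\<And>n i. i \<in> {1..n} \<Longrightarrow> integrable (P n) (\<lambda>\<omega>. (M n i \<theta> (X n i \<omega>))\<^sup>2)"
    and a_deriv: "\<And>n i. i \<in> {1..n} \<Longrightarrow> integrable (P n) (\<lambda>\<omega>. M' n i \<theta> (X n i \<omega>))"
    and b_pos: "\<forall>\<^sub>F n in sequentially. I n > 0 \<and> J n \<noteq> 0"
    and b_rate: "filterlim (\<lambda>n. \<bar>J n\<bar> / sqrt (I n)) at_top sequentially"
    and b_lln: "tendsto_in_prob P (\<lambda>n \<omega>. obs_sum X M' n \<theta> \<omega> / J n) 1"
    and b_clt: "weak_conv_m (\<lambda>n. distr (P n) borel (\<lambda>\<omega>. obs_sum X M n \<theta> \<omega> / sqrt (I n)))
                  std_normal_distribution"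
    and c: "((\<lambda>\<delta>. limsup (\<lambda>n. tau_bar P X \<Theta> \<theta> M' n \<delta>)) \<longlongrightarrow> 0) (at_right 0)"
    and d: "vanishes_in_prob P (\<lambda>n \<omega>.
              ennreal (\<bar>J n\<bar> / sqrt (I n) * \<bar>T n \<omega> - \<theta>\<bar>) *
              tau_bar P X \<Theta> \<theta> M' n \<bar>T n \<omega> - \<theta>\<bar>)"
    and e_twice_diff: "\<And>n i. i \<in> {1..n} \<Longrightarrow>
      AE \<omega> in P n. \<forall>t\<in>\<Theta>.
        ((\<lambda>s. M n i s (X n i \<omega>)) has_real_derivative M' n i t (X n i \<omega>)) (at t) \<and>
        ((\<lambda>s. M' n i s (X n i \<omega>)) has_real_derivative M'' n i t (X n i \<omega>)) (at t)"
    and e_modulus: "\<And>\<epsilon>. \<epsilon> > 0 \<Longrightarrow>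
      ((\<lambda>\<delta>. limsup (\<lambda>n. outer_measure_of (P n) {\<omega> \<in> space (P n).
          (\<Sum>i=1..n. (SUP t\<in>{t\<in>\<Theta>. \<bar>t - \<theta>\<bar> \<le> \<delta>}.
             ennreal \<bar>M'' n i t (X n i \<omega>) - M'' n i \<theta> (X n i \<omega>)\<bar>) / ennreal \<bar>J n\<bar>) > ennreal \<epsilon>}))
        \<longlongrightarrow> 0) (at_right 0)"
    and e_lln: "tendsto_in_prob P (\<lambda>n \<omega>.
      (\<Sum>i=1..n. M'' n i \<theta> (X n i \<omega>) - (LINT \<omega>'|P n. M'' n i \<theta> (X n i \<omega>'))) / J n) 0"
    and f: "tendsto_in_prob P T \<theta>"
  shows "(\<lambda>n. outer_measure_of (P n) (space (P n) - one_step_defined P X \<Theta> M' T n)) \<longlonglongrightarrow> 0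
    \<and> (\<exists>r1 r2. tendsto_in_prob P r1 0 \<and> tendsto_in_prob P r2 0 \<and>
        (\<forall>\<^sub>F n in sequentially. \<forall>\<omega> \<in> one_step_defined P X \<Theta> M' T n.
           \<Delta> n \<omega> = J n / sqrt (I n) * (T n \<omega> - \<theta>)\<^sup>2 * (K n / (2 * J n) + r1 n \<omega>) + r2 n \<omega>))
    \<and> ((\<exists>\<delta>>0. liminf (\<lambda>n. ereal (\<bar>K n\<bar> / \<bar>J n\<bar>)) \<ge> ereal \<delta>) \<longrightarrow>
        (tendsto_in_prob P (\<lambda>n \<omega>. \<bar>J n\<bar> powr (1/2) / I n powr (1/4) * \<bar>T n \<omega> - \<theta>\<bar>) 0
         \<longleftrightarrow> tendsto_in_prob P \<Delta> 0))"
proof -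

  \<comment> \<open>A neighbourhood inside the parameter set and almost sure smoothness\<close>
  let ?S0 = "obs_sum X M" and ?S1 = "obs_sum X M'" and ?S2 = "obs_sum X M''"
  have X: "X n i \<in> measurable (P n) (S n)" if "i \<in> {1..n}" for n i
    using indep[of n] that by (simp add: prob_space.indep_vars_def[OF prob])
  obtain \<delta>\<^sub>0 where \<delta>\<^sub>0: "\<delta>\<^sub>0 > 0" "\<And>t. \<bar>t - \<theta>\<bar> \<le> \<delta>\<^sub>0 \<Longrightarrow> t \<in> \<Theta>"
    using Theta by (auto simp: open_contains_cball subset_iff dist_real_def abs_minus_commute)
  have J0: "\<forall>\<^sub>F n in sequentially. J n \<noteq> 0"
    using b_pos by eventually_elim simp

  define smooth where "smooth n \<omega> \<longleftrightarrow> (\<forall>t\<in>\<Theta>.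
      ((\<lambda>s. ?S0 n s \<omega>) has_real_derivative ?S1 n t \<omega>) (at t) \<and>
      ((\<lambda>s. ?S1 n s \<omega>) has_real_derivative ?S2 n t \<omega>) (at t))" for n \<omega>
  \<comment> \<open>For each \<open>n\<close> there are finitely many observations, so their null
    sets merge into one; the quantifier over \<open>t\<close> already stands inside the almost sure
    statement.\<close>
  have AE_smooth: "AE \<omega> in P n. smooth n \<omega>" for n
  proof -
    have "AE \<omega> in P n. \<forall>i\<in>{1..n}. \<forall>t\<in>\<Theta>.
        ((\<lambda>s. M n i s (X n i \<omega>)) has_real_derivative M' n i t (X n i \<omega>)) (at t) \<and>
        ((\<lambda>s. M' n i s (X n i \<omega>)) has_real_derivative M'' n i t (X n i \<omega>)) (at t)"
      by (rule AE_finite_allI) (use e_twice_diff in auto)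
    then show ?thesis
      unfolding smooth_def
      by eventually_elim (blast intro: obs_sum_has_derivative)
  qed

  \<comment> \<open>Uniform closeness of the second derivative to its mean\<close>
  \<comment> \<open>The comparison is with the deterministic \<open>K n / J n\<close>, and over all
    \<open>t\<close> within radius \<open>r\<close>, so that \<open>r\<close> may later be the
    random distance of \<open>T\<close> from \<open>\<theta>\<close>.\<close>
  define far where "far e n r \<omega> \<longleftrightarrow>
      (\<exists>t\<in>\<Theta>. \<bar>t - \<theta>\<bar> \<le> r \<and> \<bar>?S2 n t \<omega> / J n - K n / J n\<bar> > e)" for e n r \<omega>

  have far_small: "\<forall>\<^sub>F \<delta> in at_right 0. \<forall>\<^sub>F n in sequentially.
      outer_measure_of (P n) {\<omega> \<in> space (P n). far e n \<delta> \<omega>} < ennreal \<eta>"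
    if "e > 0" "\<eta> > 0" for e \<eta>
  proof -
    \<comment> \<open>The deviation splits in two halves of size \<open>e/2\<close>:
      \<open>A\<close> is the oscillation around \<open>\<theta>\<close>, small by the modulus in
      (e); \<open>B\<close> is the centring error at \<open>\<theta>\<close>, small by the law of
      large numbers in (e).\<close>
    define A where "A n \<delta> \<omega> \<longleftrightarrow> (\<Sum>i=1..n. (SUP t\<in>{t\<in>\<Theta>. \<bar>t - \<theta>\<bar> \<le> \<delta>}.
        ennreal \<bar>M'' n i t (X n i \<omega>) - M'' n i \<theta> (X n i \<omega>)\<bar>) / ennreal \<bar>J n\<bar>) > ennreal (e/2)"
      for n \<delta> \<omega>
    define B where "B n \<omega> \<longleftrightarrow> \<bar>?S2 n \<theta> \<omega> / J n - K n / J n\<bar> > e/2" for n \<omega>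
    have A: "\<forall>\<^sub>F \<delta> in at_right 0.
        limsup (\<lambda>n. outer_measure_of (P n) {\<omega> \<in> space (P n). A n \<delta> \<omega>}) < ennreal (\<eta>/2)"
      using order_tendstoD(2)[OF e_modulus[of "e/2"], of "ennreal (\<eta>/2)"] that by (simp add: A_def)
    have B: "\<forall>\<^sub>F n in sequentially.
        outer_measure_of (P n) {\<omega> \<in> space (P n). B n \<omega>} < ennreal (\<eta>/2)"
    proof (rule vanishing_eventD)
      have eq: "(\<Sum>i=1..n. M'' n i \<theta> (X n i \<omega>) - (LINT \<omega>'|P n. M'' n i \<theta> (X n i \<omega>'))) / J n - 0
          = ?S2 n \<theta> \<omega> / J n - K n / J n" for n \<omega>
        by (simp add: obs_sum_def K_def mean_sum_def sum_subtractf diff_divide_distrib)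
      show "vanishing_event P B"
        using tendsto_in_probD[OF e_lln, of "e/2"] \<open>e > 0\<close> unfolding eq B_def[abs_def] by simp
    qed (use that in simp)
    from A show ?thesis
    proof (rule eventually_mono)
      fix \<delta>
      assume "limsup (\<lambda>n. outer_measure_of (P n) {\<omega> \<in> space (P n). A n \<delta> \<omega>}) < ennreal (\<eta>/2)"
      then have "\<forall>\<^sub>F n in sequentially.
          outer_measure_of (P n) {\<omega> \<in> space (P n). A n \<delta> \<omega>} < ennreal (\<eta>/2)"
        by (rule Limsup_lessD)
      then show "\<forall>\<^sub>F n in sequentially.
          outer_measure_of (P n) {\<omega> \<in> space (P n). far e n \<delta> \<omega>} < ennreal \<eta>"
        using B J0
      proof eventually_elim
        case (elim n)
        have "A n \<delta> \<omega> \<or> B n \<omega>" if far: "far e n \<delta> \<omega>" for \<omega>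
        proof (rule ccontr)
          assume not: "\<not> (A n \<delta> \<omega> \<or> B n \<omega>)"
          obtain t where t: "t \<in> \<Theta>" "\<bar>t - \<theta>\<bar> \<le> \<delta>" "\<bar>?S2 n t \<omega> / J n - K n / J n\<bar> > e"
            using far by (auto simp: far_def)
          have "ennreal \<bar>?S2 n t \<omega> / J n - ?S2 n \<theta> \<omega> / J n\<bar> \<le> ennreal (e/2)"
            using obs_sum_diff_le_SUP[OF elim(3), of t "{t\<in>\<Theta>. \<bar>t - \<theta>\<bar> \<le> \<delta>}" X M'' n \<omega> \<theta>] t not
            by (auto simp: A_def)
          then have "\<bar>?S2 n t \<omega> / J n - ?S2 n \<theta> \<omega> / J n\<bar> \<le> e/2"
            using \<open>e > 0\<close> by simp
          moreover have "\<bar>?S2 n \<theta> \<omega> / J n - K n / J n\<bar> \<le> e/2" using not by (simp add: B_def)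
          ultimately show False using t(3) by linarith
        qed
        then have "outer_measure_of (P n) {\<omega> \<in> space (P n). far e n \<delta> \<omega>}
          \<le> outer_measure_of (P n) {\<omega> \<in> space (P n). A n \<delta> \<omega> \<or> B n \<omega>}"
          by (intro outer_measure_of_mono) auto
        also have "\<dots> \<le> outer_measure_of (P n) {\<omega> \<in> space (P n). A n \<delta> \<omega>}
            + outer_measure_of (P n) {\<omega> \<in> space (P n). B n \<omega>}" by (rule outer_measure_of_disj_le)
        also have "\<dots> < ennreal (\<eta>/2) + ennreal (\<eta>/2)" using elim by (intro add_strict_mono)
        also have "\<dots> = ennreal \<eta>" using \<open>\<eta> > 0\<close> by (simp flip: ennreal_plus)
        finally show ?case .
      qed
    qed
  qed

  \<comment> \<open>Boundedness of \<open>K / J\<close>\<close>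
  text \<open>The mean value theorem on \<open>[\<theta>, \<theta> + \<delta>]\<close> turns the bound on \<open>\<tau>\<close> into one on \<open>K / J\<close>: both
    constraints on the second derivative hold with positive probability, hence at some point.\<close>
  obtain C where C: "C > 0" "\<forall>\<^sub>F n in sequentially. \<bar>K n / J n\<bar> \<le> C"
  proof -
    \<comment> \<open>The budget: Markov's inequality at level 1 turns this 1/2 into a probability
      of at most 1/2 for \<open>1 \<le> D\<close>; with 1/4 for \<open>far 1\<close> the total 3/4
      stays below 1.\<close>
    have "\<forall>\<^sub>F \<delta> in at_right 0. limsup (\<lambda>n. tau_bar P X \<Theta> \<theta> M' n \<delta>) < ennreal (1/2)"
      by (rule order_tendstoD(2)[OF c]) (subst ennreal_less_zero_iff, simp)
    moreover have "\<forall>\<^sub>F \<delta> in at_right 0. 0 < \<delta> \<and> \<delta> < \<delta>\<^sub>0"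
      using \<delta>\<^sub>0(1) by (auto simp: eventually_at_right_field intro!: exI[of _ \<delta>\<^sub>0])
    moreover have "\<forall>\<^sub>F \<delta> in at_right 0. \<forall>\<^sub>F n in sequentially.
        outer_measure_of (P n) {\<omega> \<in> space (P n). far 1 n \<delta> \<omega>} < ennreal (1/4)"
      by (rule far_small) simp_all
    ultimately have "\<forall>\<^sub>F \<delta> in at_right (0::real).
        limsup (\<lambda>n. tau_bar P X \<Theta> \<theta> M' n \<delta>) < ennreal (1/2) \<and> (0 < \<delta> \<and> \<delta> < \<delta>\<^sub>0) \<and>
        (\<forall>\<^sub>F n in sequentially.
          outer_measure_of (P n) {\<omega> \<in> space (P n). far 1 n \<delta> \<omega>} < ennreal (1/4))"
      by (simp only: eventually_conj_iff)
    then obtain \<delta> where \<delta>: "limsup (\<lambda>n. tau_bar P X \<Theta> \<theta> M' n \<delta>) < ennreal (1/2)" "0 < \<delta>" "\<delta> < \<delta>\<^sub>0"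
      and far: "\<forall>\<^sub>F n in sequentially.
          outer_measure_of (P n) {\<omega> \<in> space (P n). far 1 n \<delta> \<omega>} < ennreal (1/4)"
      using eventually_happens'[OF trivial_limit_at_right_real] by blast
    have "\<forall>\<^sub>F n in sequentially. tau_bar P X \<Theta> \<theta> M' n \<delta> < ennreal (1/2)"
      by (rule Limsup_lessD) (rule \<delta>(1))
    then have "\<forall>\<^sub>F n in sequentially. \<bar>K n / J n\<bar> \<le> 1 / \<delta> + 1"
      using far J0
    proof eventually_elim
      case (elim n)
      interpret prob_space "P n" by (rule prob)
      \<comment> \<open>The increment is taken at the single deterministic point
        \<open>\<theta> + \<delta>\<close>, which keeps \<open>D\<close> measurable for Markov's
        inequality.\<close>
      define D where "D \<omega> = \<bar>?S1 n (\<theta> + \<delta>) \<omega> / J n - ?S1 n \<theta> \<omega> / J n\<bar>" for \<omega>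
      have in_\<Theta>: "\<theta> + \<delta> \<in> \<Theta>" using \<delta> \<delta>\<^sub>0(2) by simp
      have [measurable]: "?S1 n t \<in> borel_measurable (P n)" if "t \<in> \<Theta>" for t
        using obs_sum_measurable[of n X "P n" "S n" M' t] X meas_M' that by blast
      have D_meas [measurable]: "D \<in> borel_measurable (P n)"
        unfolding D_def using in_\<Theta> Theta(2) by measurable
      have "emeasure (P n) {\<omega> \<in> space (P n). 1 \<le> 1 * ennreal (D \<omega>)}
          \<le> 1 * (\<integral>\<^sup>+\<omega>. ennreal (D \<omega>) * indicator (space (P n)) \<omega> \<partial>P n)"
        by (rule nn_integral_Markov_inequality) auto
      also have "\<dots> = (\<integral>\<^sup>+\<omega>. ennreal (D \<omega>) \<partial>P n)"
        by (auto intro!: nn_integral_cong)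
      also have "\<dots> \<le> tau_bar P X \<Theta> \<theta> M' n \<delta>"
        unfolding D_def J_def
        by (rule nn_integral_obs_sum_diff_le_tau_bar[where S=S])
           (use X meas_M' elim(3) in_\<Theta> Theta(2) \<delta>(2) in \<open>auto simp: J_def\<close>)
      finally have "outer_measure_of (P n) {\<omega> \<in> space (P n). 1 \<le> D \<omega>} \<le> ennreal (1/2)"
        using elim(1) by simp
      moreover have "outer_measure_of (P n) {\<omega> \<in> space (P n). \<not> smooth n \<omega>} = 0"
        using AE_smooth by (intro outer_measure_of_AE_eq_0) auto
      ultimately have "outer_measure_of (P n) {\<omega> \<in> space (P n). (1 \<le> D \<omega> \<or> \<not> smooth n \<omega>) \<or> far 1 n \<delta> \<omega>}
          \<le> (ennreal (1/2) + 0) + ennreal (1/4)"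
        using less_imp_le[OF elim(2)]
        by (intro order_trans[OF outer_measure_of_disj_le] add_mono) auto
      also have "\<dots> = ennreal (3/4)"
        unfolding add_0_right by (subst ennreal_plus[symmetric]) auto
      also have "ennreal (3/4) < 1"
        by (subst ennreal_less_one_iff) simp
      finally have "\<exists>\<omega>\<in>space (P n). \<not> ((1 \<le> D \<omega> \<or> \<not> smooth n \<omega>) \<or> far 1 n \<delta> \<omega>)"
        by (rule exists_if_outer_measure_lt_1)
      \<comment> \<open>\<open>K n / J n\<close> does not depend on \<open>\<omega>\<close>, so a
        bound found at one sample point holds outright.\<close>
      then obtain \<omega> where "\<not> ((1 \<le> D \<omega> \<or> \<not> smooth n \<omega>) \<or> far 1 n \<delta> \<omega>)" by blast
      then have \<omega>: "D \<omega> < 1" "smooth n \<omega>" "\<not> far 1 n \<delta> \<omega>" by auto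
      obtain \<xi> where \<xi>: "\<theta> < \<xi>" "\<xi> < \<theta> + \<delta>"
        "?S1 n (\<theta> + \<delta>) \<omega> - ?S1 n \<theta> \<omega> = (\<theta> + \<delta> - \<theta>) * ?S2 n \<xi> \<omega>"
        using MVT2[of \<theta> "\<theta> + \<delta>" "\<lambda>s. ?S1 n s \<omega>" "\<lambda>s. ?S2 n s \<omega>"] \<omega>(2) \<delta> \<delta>\<^sub>0(2)
        by (auto simp: smooth_def)
      have "\<delta> * \<bar>?S2 n \<xi> \<omega> / J n\<bar> = D \<omega>"
        using \<xi>(3) \<delta>(2) unfolding D_def diff_divide_distrib[symmetric] by (simp add: abs_mult)
      then have "\<bar>?S2 n \<xi> \<omega> / J n\<bar> \<le> 1 / \<delta>" using \<omega>(1) \<delta>(2) by (simp add: field_simps)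
      moreover have "\<bar>?S2 n \<xi> \<omega> / J n - K n / J n\<bar> \<le> 1"
        using \<omega>(3) \<xi>(1,2) \<delta> \<delta>\<^sub>0(2)[of \<xi>] by (auto simp: far_def not_less)
      ultimately show ?case by linarith
    qed
    with \<delta>(2) show ?thesis by (intro that[of "1 / \<delta> + 1"]) (auto intro: add_pos_pos)
  qed

  \<comment> \<open>Exceptional events of the second-order expansion\<close>
  have T_conv: "vanishing_event P (\<lambda>n \<omega>. \<bar>T n \<omega> - \<theta>\<bar> > \<delta>)" if "\<delta> > 0" for \<delta>
    using f that by (rule tendsto_in_probD)

  \<comment> \<open>Off \<open>bad e\<close> the segment from \<open>\<theta>\<close> to
    \<open>T\<close> lies in \<open>\<Theta>\<close>, the sums are twice differentiable there, and
    the second derivative over \<open>J\<close> is within \<open>e\<close> of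
    \<open>K / J\<close>.\<close>
  define bad where "bad e n \<omega> \<longleftrightarrow>
      (\<not> smooth n \<omega> \<or> \<bar>T n \<omega> - \<theta>\<bar> > \<delta>\<^sub>0) \<or> far e n \<bar>T n \<omega> - \<theta>\<bar> \<omega>" for e n \<omega>
  have bad: "vanishing_event P (bad e)" if "e > 0" for e
    unfolding bad_def[abs_def]
  proof (intro vanishing_event_disj T_conv \<delta>\<^sub>0(1))
    show "vanishing_event P (\<lambda>n \<omega>. \<not> smooth n \<omega>)"
      using AE_smooth by (intro vanishing_event_AE) auto
    show "vanishing_event P (\<lambda>n \<omega>. far e n \<bar>T n \<omega> - \<theta>\<bar> \<omega>)"
    \<comment> \<open>The random radius is exchanged for a fixed \<open>\<delta>\<close>: either
      \<open>T\<close> is farther than \<open>\<delta>\<close> from \<open>\<theta>\<close>, which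
      vanishes by consistency, or \<open>far\<close> already holds with radius
      \<open>\<delta>\<close>.\<close>
    proof (rule vanishing_event_approx)
      fix \<eta> :: real assume "\<eta> > 0"
      have "\<forall>\<^sub>F \<delta> in at_right 0. 0 < \<delta> \<and> (\<forall>\<^sub>F n in sequentially.
          outer_measure_of (P n) {\<omega> \<in> space (P n). far e n \<delta> \<omega>} < ennreal \<eta>)"
        using far_small[OF that \<open>\<eta> > 0\<close>] by (intro eventually_conj eventually_at_right_less)
      then obtain \<delta> where \<delta>: "\<delta> > 0" "\<forall>\<^sub>F n in sequentially.
          outer_measure_of (P n) {\<omega> \<in> space (P n). far e n \<delta> \<omega>} < ennreal \<eta>"
        using eventually_happens'[OF trivial_limit_at_right_real] by blast
      have far_mono: "\<bar>T n \<omega> - \<theta>\<bar> > \<delta> \<or> far e n \<delta> \<omega>" if "far e n \<bar>T n \<omega> - \<theta>\<bar> \<omega>" for n \<omega>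
        using that unfolding far_def by force
      show "\<exists>R R'. vanishing_event P R \<and>
          (\<forall>\<^sub>F n in sequentially. outer_measure_of (P n) {\<omega> \<in> space (P n). R' n \<omega>} < ennreal \<eta>) \<and>
          (\<forall>\<^sub>F n in sequentially. \<forall>\<omega>\<in>space (P n). far e n \<bar>T n \<omega> - \<theta>\<bar> \<omega> \<longrightarrow> R n \<omega> \<or> R' n \<omega>)"
        by (rule exI[of _ "\<lambda>n \<omega>. \<bar>T n \<omega> - \<theta>\<bar> > \<delta>"], rule exI[of _ "\<lambda>n. far e n \<delta>"])
           (use T_conv[OF \<delta>(1)] \<delta>(2) far_mono in simp)
    qed
  qed

  \<comment> \<open>The quotients \<open>V\<close> and \<open>W\<close>\<close>
  define V where "V n \<omega> = ?S1 n (T n \<omega>) \<omega> / J n" for n \<omega>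
  \<comment> \<open>At \<open>T = \<theta>\<close> the denominator is 0 and \<open>W\<close> takes
    the value 0, so its estimate below is restricted to \<open>T \<noteq> \<theta>\<close>.\<close>
  define W where "W n \<omega> = ((T n \<omega> - \<theta>) * ?S1 n (T n \<omega>) \<omega> - ?S0 n (T n \<omega>) \<omega> + ?S0 n \<theta> \<omega>)
      / (J n * (T n \<omega> - \<theta>)\<^sup>2)" for n \<omega>
  define A where "A n \<omega> = ?S0 n \<theta> \<omega> / sqrt (I n)" for n \<omega>
  have not_bad: "\<bar>V n \<omega> - ?S1 n \<theta> \<omega> / J n\<bar> \<le> \<bar>T n \<omega> - \<theta>\<bar> * (\<bar>K n / J n\<bar> + e)"
      "T n \<omega> \<noteq> \<theta> \<Longrightarrow> \<bar>W n \<omega> - (K n / J n) / 2\<bar> \<le> e / 2"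
    if "\<not> bad e n \<omega>" "J n \<noteq> 0" for e n \<omega>
  proof -
    have near: "s \<in> \<Theta>" if "\<bar>s - \<theta>\<bar> \<le> \<bar>T n \<omega> - \<theta>\<bar>" for s
      using that \<open>\<not> bad e n \<omega>\<close> by (intro \<delta>\<^sub>0(2)) (simp add: bad_def)
    have derivs: "((\<lambda>s. ?S0 n s \<omega>) has_real_derivative ?S1 n s \<omega>) (at s)"
        "((\<lambda>s. ?S1 n s \<omega>) has_real_derivative ?S2 n s \<omega>) (at s)"
        "\<bar>?S2 n s \<omega> / J n - K n / J n\<bar> \<le> e"
      if "\<bar>s - \<theta>\<bar> \<le> \<bar>T n \<omega> - \<theta>\<bar>" for s
      using near[OF that] that \<open>\<not> bad e n \<omega>\<close> by (auto simp: bad_def smooth_def far_def not_less)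
    note expansion = second_order_expansion[where F="\<lambda>s. ?S0 n s \<omega>" and F'="\<lambda>s. ?S1 n s \<omega>"
        and F''="\<lambda>s. ?S2 n s \<omega>" and t=\<theta> and T="T n \<omega>" and j="J n" and k="K n / J n" and e=e]
    show "\<bar>V n \<omega> - ?S1 n \<theta> \<omega> / J n\<bar> \<le> \<bar>T n \<omega> - \<theta>\<bar> * (\<bar>K n / J n\<bar> + e)"
      unfolding V_def by (intro expansion(1) derivs \<open>J n \<noteq> 0\<close>)
    show "\<bar>W n \<omega> - (K n / J n) / 2\<bar> \<le> e / 2" if "T n \<omega> \<noteq> \<theta>"
      unfolding W_def by (intro expansion(2) derivs \<open>J n \<noteq> 0\<close> that)
  qed

  have V: "vanishing_event P (\<lambda>n \<omega>. \<bar>V n \<omega> - 1\<bar> > \<epsilon>)" if "\<epsilon> > 0" for \<epsilon>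
  proof (rule vanishing_event_mono)
    \<comment> \<open>Half of \<open>\<epsilon>\<close> goes to the law of large numbers at
      \<open>\<theta>\<close>. The other half is the change from \<open>\<theta>\<close> to
      \<open>T\<close>, whose rate is at most \<open>C + 1\<close> off \<open>bad 1\<close>; hence
      the radius for \<open>T\<close>.\<close>
    let ?R = "\<lambda>n \<omega>. (\<bar>?S1 n \<theta> \<omega> / J n - 1\<bar> > \<epsilon>/2 \<or> bad 1 n \<omega>) \<or> \<bar>T n \<omega> - \<theta>\<bar> > \<epsilon> / (2 * (C + 1))"
    show "vanishing_event P ?R"
      using that C(1) by (intro vanishing_event_disj bad T_conv tendsto_in_probD[OF b_lln]) auto
    show "\<forall>\<^sub>F n in sequentially. \<forall>\<omega>\<in>space (P n). \<bar>V n \<omega> - 1\<bar> > \<epsilon> \<longrightarrow> ?R n \<omega>"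
      using C(2) J0
    proof eventually_elim
      case (elim n)
      have "\<bar>V n \<omega> - 1\<bar> \<le> \<epsilon>" if "\<not> ?R n \<omega>" for \<omega>
      proof -
        have "\<bar>V n \<omega> - ?S1 n \<theta> \<omega> / J n\<bar> \<le> \<bar>T n \<omega> - \<theta>\<bar> * (\<bar>K n / J n\<bar> + 1)"
          using not_bad(1)[of 1 n \<omega>] that elim(2) by simp
        also have "\<dots> \<le> \<epsilon> / (2 * (C + 1)) * (C + 1)"
          using that elim(1) C(1) \<open>\<epsilon> > 0\<close> by (intro mult_mono) auto
        also have "\<dots> = \<epsilon>/2" using C(1) by (simp add: field_simps)
        finally show ?thesis using that by linarith
      qed
      then show ?case by (metis diff_zero linorder_not_less)
    qed
  qed

  \<comment> \<open>The two remainders\<close>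
  \<comment> \<open>At \<open>T = \<theta>\<close> the factor multiplying \<open>r1\<close> is 0, so
    the value 0 preserves the expansion and avoids the degenerate \<open>W\<close>.\<close>
  define r1 where "r1 n \<omega> =
      (if T n \<omega> - \<theta> = 0 then 0 else W n \<omega> / V n \<omega> - K n / (2 * J n))" for n \<omega>
  define r2 where "r2 n \<omega> = A n \<omega> * (1 - 1 / V n \<omega>)" for n \<omega>

  have r1: "tendsto_in_prob P r1 0"
    unfolding tendsto_in_prob_iff_vanishing
  proof (intro allI impI)
    fix \<epsilon> :: real assume "\<epsilon> > 0"
    \<comment> \<open>With \<open>k = K / J\<close>, the remainder is
      \<open>(W - k/2) / V - k/2 * (1 - 1/V)\<close>. The first term is at most
      \<open>\<epsilon>/4 * 2\<close>, the second at most \<open>C/2 * 2 * \<kappa>\<close>, and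
      this \<open>\<kappa>\<close> makes each at most \<open>\<epsilon>/2\<close>.\<close>
    define \<kappa> where "\<kappa> = min (1/2) (\<epsilon> / (2 * C))"
    have \<kappa>: "\<kappa> > 0" "\<kappa> \<le> 1/2" "C * \<kappa> \<le> \<epsilon>/2"
      using \<open>\<epsilon> > 0\<close> C(1) by (auto simp: \<kappa>_def min_def field_simps)
    let ?R = "\<lambda>n \<omega>. bad (\<epsilon>/2) n \<omega> \<or> \<bar>V n \<omega> - 1\<bar> > \<kappa>"
    show "vanishing_event P (\<lambda>n \<omega>. \<epsilon> < \<bar>r1 n \<omega> - 0\<bar>)"
    proof (rule vanishing_event_mono)
      show "vanishing_event P ?R"
        using \<kappa> \<open>\<epsilon> > 0\<close> by (intro vanishing_event_disj bad V) auto
      show "\<forall>\<^sub>F n in sequentially. \<forall>\<omega>\<in>space (P n). \<epsilon> < \<bar>r1 n \<omega> - 0\<bar> \<longrightarrow> ?R n \<omega>"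
        using C(2) J0
      proof eventually_elim
        case (elim n)
        have "\<bar>r1 n \<omega>\<bar> \<le> \<epsilon>" if good: "\<not> ?R n \<omega>" for \<omega>
        proof (cases "T n \<omega> = \<theta>")
          case False
          let ?k = "K n / J n"
          have v: "\<bar>V n \<omega> - 1\<bar> \<le> \<kappa>" "\<bar>1 - 1 / V n \<omega>\<bar> \<le> 2 * \<bar>V n \<omega> - 1\<bar>" "\<bar>1 / V n \<omega>\<bar> \<le> 2"
            using good \<kappa>(2) abs_one_minus_inverse_le[of "V n \<omega>"] by auto
          have w: "\<bar>W n \<omega> - ?k / 2\<bar> \<le> \<epsilon> / 4"
            using not_bad(2)[of "\<epsilon>/2" n \<omega>] good elim(2) False by simp
          have "r1 n \<omega> = (W n \<omega> - ?k / 2) * (1 / V n \<omega>) - ?k / 2 * (1 - 1 / V n \<omega>)"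
            using False by (simp add: r1_def algebra_simps diff_divide_distrib)
          also have "\<bar>\<dots>\<bar> \<le> \<bar>W n \<omega> - ?k / 2\<bar> * \<bar>1 / V n \<omega>\<bar> + \<bar>?k / 2\<bar> * \<bar>1 - 1 / V n \<omega>\<bar>"
            by (intro order_trans[OF abs_triangle_ineq4]) (simp add: abs_mult)
          also have "\<dots> \<le> \<epsilon> / 4 * 2 + C / 2 * (2 * \<kappa>)"
            using v w elim(1) \<open>\<epsilon> > 0\<close> C(1) by (intro add_mono mult_mono) auto
          also have "\<dots> \<le> \<epsilon>" using \<kappa>(3) by simp
          finally show ?thesis .
        qed (use \<open>\<epsilon> > 0\<close> in \<open>simp add: r1_def\<close>)
        then show ?case by (metis diff_zero linorder_not_less)
      qed
    qed
  qed

  have r2: "tendsto_in_prob P r2 0"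
    unfolding tendsto_in_prob_iff_vanishing
  proof (intro allI impI vanishing_event_approx)
    fix \<epsilon> \<eta> :: real assume "\<epsilon> > 0" "\<eta> > 0"
    \<comment> \<open>A Slutsky argument: \<open>A\<close> is only bounded in probability, so a
      bound \<open>B\<close> valid outside an event below \<open>\<eta>\<close> is fixed first, and
      \<open>\<kappa>\<close> is then fitted to \<open>B\<close>.\<close>
    have "A n \<in> borel_measurable (P n)" for n
      unfolding A_def using obs_sum_measurable[of n X "P n" "S n" M \<theta>] X meas_M Theta(2)
      by (intro borel_measurable_divide) auto
    then obtain B where B: "B > 0"
      "\<forall>\<^sub>F n in sequentially. outer_measure_of (P n) {\<omega> \<in> space (P n). \<bar>A n \<omega>\<bar> > B} < ennreal \<eta>"
      using weak_conv_m_imp_bounded_in_prob[of P A std_normal_distribution \<eta>] prob b_clt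
        real_dist_normal_dist isCont_cdf_std_normal \<open>\<eta> > 0\<close> unfolding A_def[abs_def] by blast
    define \<kappa> where "\<kappa> = min (1/2) (\<epsilon> / (2 * B))"
    have \<kappa>: "\<kappa> > 0" "\<kappa> \<le> 1/2" "B * (2 * \<kappa>) \<le> \<epsilon>"
      using \<open>\<epsilon> > 0\<close> B(1) by (auto simp: \<kappa>_def min_def field_simps)
    have r2_large: "\<bar>V n \<omega> - 1\<bar> > \<kappa> \<or> \<bar>A n \<omega>\<bar> > B" if "\<epsilon> < \<bar>r2 n \<omega>\<bar>" for n \<omega>
    proof (rule ccontr)
      assume "\<not> ?thesis"
      then have "\<bar>r2 n \<omega>\<bar> \<le> B * (2 * \<kappa>)"
        unfolding r2_def abs_mult using \<kappa>(2) B(1) abs_one_minus_inverse_le(1)[of "V n \<omega>"]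
        by (intro mult_mono) auto
      with \<kappa>(3) that show False by simp
    qed
    show "\<exists>R R'. vanishing_event P R \<and>
        (\<forall>\<^sub>F n in sequentially. outer_measure_of (P n) {\<omega> \<in> space (P n). R' n \<omega>} < ennreal \<eta>) \<and>
        (\<forall>\<^sub>F n in sequentially. \<forall>\<omega>\<in>space (P n). \<epsilon> < \<bar>r2 n \<omega> - 0\<bar> \<longrightarrow> R n \<omega> \<or> R' n \<omega>)"
      by (rule exI[of _ "\<lambda>n \<omega>. \<bar>V n \<omega> - 1\<bar> > \<kappa>"], rule exI[of _ "\<lambda>n \<omega>. \<bar>A n \<omega>\<bar> > B"])
         (use V[OF \<kappa>(1)] B(2) r2_large in simp)
  qed

  \<comment> \<open>Existence of the estimator and the expansion\<close>
  let ?D = "one_step_defined P X \<Theta> M' T"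
  have undef: "vanishing_event P (\<lambda>n \<omega>. \<omega> \<notin> ?D n)"
  proof (rule vanishing_event_mono)
    \<comment> \<open>Distance at most \<open>\<delta>\<^sub>0\<close> puts \<open>T\<close> into
      \<open>\<Theta>\<close>, and \<open>V\<close> within 1/2 of 1 rules out a zero
      denominator.\<close>
    let ?R = "\<lambda>n \<omega>. \<bar>T n \<omega> - \<theta>\<bar> > \<delta>\<^sub>0 \<or> \<bar>V n \<omega> - 1\<bar> > 1/2"
    show "vanishing_event P ?R"
      using \<delta>\<^sub>0(1) by (intro vanishing_event_disj T_conv V) auto
    show "\<forall>\<^sub>F n in sequentially. \<forall>\<omega>\<in>space (P n). \<omega> \<notin> ?D n \<longrightarrow> ?R n \<omega>"
    proof (intro always_eventually allI ballI impI)
      fix n \<omega> assume "\<omega> \<in> space (P n)" "\<omega> \<notin> ?D n"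
      then have "T n \<omega> \<notin> \<Theta> \<or> V n \<omega> = 0" by (auto simp: one_step_defined_def V_def)
      then show "?R n \<omega>"
      proof
        assume "T n \<omega> \<notin> \<Theta>"
        then have "\<not> \<bar>T n \<omega> - \<theta>\<bar> \<le> \<delta>\<^sub>0" using \<delta>\<^sub>0(2) by blast
        then show ?thesis by simp
      qed simp
    qed
  qed

  have expansion: "\<forall>\<^sub>F n in sequentially. \<forall>\<omega> \<in> ?D n.
      \<Delta> n \<omega> = J n / sqrt (I n) * (T n \<omega> - \<theta>)\<^sup>2 * (K n / (2 * J n) + r1 n \<omega>) + r2 n \<omega>"
    using J0
  proof eventually_elim
    case (elim n)
    show ?case
    proof
      fix \<omega> assume "\<omega> \<in> ?D n"
      then have S1: "?S1 n (T n \<omega>) \<omega> \<noteq> 0" by (simp add: one_step_defined_def)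
      show "\<Delta> n \<omega> = J n / sqrt (I n) * (T n \<omega> - \<theta>)\<^sup>2 * (K n / (2 * J n) + r1 n \<omega>) + r2 n \<omega>"
        \<comment> \<open>The commuting rule regroups the Newton step minus \<open>\<theta>\<close>
          as \<open>T - \<theta>\<close> minus the quotient, the form of
          \<open>one_step_identity\<close>.\<close>
        unfolding \<Delta>_def Delta_def one_step_def r1_def r2_def V_def W_def A_def I_def[symmetric] J_def[symmetric]
          cancel_ab_semigroup_add_class.diff_right_commute[of "T n \<omega>" "?S0 n (T n \<omega>) \<omega> / ?S1 n (T n \<omega>) \<omega>" \<theta>]
        by (rule one_step_identity) (use elim S1 in auto)
    qed
  qed

  \<comment> \<open>The necessary and sufficient condition\<close>
  \<comment> \<open>\<open>a\<close> is, for large \<open>n\<close>, the modulus of the factor in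
    front of the bracket in the expansion, and also the square of the quantity in the condition.
    Squaring preserves order on nonnegative reals, so both tend to 0 in probability
    together.\<close>
  define a where "a n \<omega> = \<bar>J n\<bar> / sqrt (I n) * (T n \<omega> - \<theta>)\<^sup>2" for n \<omega>
  have root: "\<forall>\<^sub>F n in sequentially. \<forall>\<omega>.
      a n \<omega> = (\<bar>J n\<bar> powr (1/2) / I n powr (1/4) * \<bar>T n \<omega> - \<theta>\<bar>)\<^sup>2"
    using b_pos
  proof eventually_elim
    case (elim n)
    have "(I n powr (1/4))\<^sup>2 = sqrt (I n)"
      using elim by (simp add: powr_power powr_half_sqrt)
    then show ?case
      using elim by (simp add: a_def power_mult_distrib power_divide powr_half_sqrt)
  qed
  have root_iff: "tendsto_in_prob P (\<lambda>n \<omega>. \<bar>J n\<bar> powr (1/2) / I n powr (1/4) * \<bar>T n \<omega> - \<theta>\<bar>) 0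
      \<longleftrightarrow> tendsto_in_prob P a 0" (is "tendsto_in_prob P ?q 0 \<longleftrightarrow> _")
  proof
    have q_nonneg: "?q n \<omega> \<ge> 0" for n \<omega> by simp
    assume q: "tendsto_in_prob P ?q 0"
    show "tendsto_in_prob P a 0"
      unfolding tendsto_in_prob_iff_vanishing
    proof (intro allI impI)
      fix \<epsilon> :: real assume "\<epsilon> > 0"
      show "vanishing_event P (\<lambda>n \<omega>. \<epsilon> < \<bar>a n \<omega> - 0\<bar>)"
      proof (rule vanishing_event_mono)
        show "vanishing_event P (\<lambda>n \<omega>. \<bar>?q n \<omega> - 0\<bar> > sqrt \<epsilon>)"
          using \<open>\<epsilon> > 0\<close> by (intro tendsto_in_probD[OF q]) simp
        show "\<forall>\<^sub>F n in sequentially. \<forall>\<omega>\<in>space (P n). \<epsilon> < \<bar>a n \<omega> - 0\<bar> \<longrightarrow> \<bar>?q n \<omega> - 0\<bar> > sqrt \<epsilon>"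
          using root
        proof eventually_elim
          case (elim n)
          have "sqrt \<epsilon> < ?q n \<omega>" if "\<epsilon> < (?q n \<omega>)\<^sup>2" for \<omega>
            using real_less_lsqrt real_sqrt_less_mono[OF that] by (simp only: real_sqrt_abs abs_of_nonneg[OF q_nonneg])
          then show ?case using elim by (simp only: abs_of_nonneg[OF q_nonneg] diff_zero abs_power2) blast
        qed
      qed
    qed
  next
    assume a: "tendsto_in_prob P a 0"
    show "tendsto_in_prob P ?q 0"
      unfolding tendsto_in_prob_iff_vanishing
    proof (intro allI impI)
      fix \<epsilon> :: real assume "\<epsilon> > 0"
      show "vanishing_event P (\<lambda>n \<omega>. \<epsilon> < \<bar>?q n \<omega> - 0\<bar>)"
      proof (rule vanishing_event_mono)
        show "vanishing_event P (\<lambda>n \<omega>. \<bar>a n \<omega> - 0\<bar> > \<epsilon>\<^sup>2)"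
          using \<open>\<epsilon> > 0\<close> by (intro tendsto_in_probD[OF a]) simp
        show "\<forall>\<^sub>F n in sequentially. \<forall>\<omega>\<in>space (P n). \<epsilon> < \<bar>?q n \<omega> - 0\<bar> \<longrightarrow> \<bar>a n \<omega> - 0\<bar> > \<epsilon>\<^sup>2"
          using root
        proof eventually_elim
          case (elim n)
          have "\<epsilon>\<^sup>2 < (?q n \<omega>)\<^sup>2" if "\<epsilon> < \<bar>?q n \<omega>\<bar>" for \<omega>
            using power_strict_mono[OF that, of 2] \<open>\<epsilon> > 0\<close> by (simp only: power2_abs)
          then show ?case using elim by (simp only: diff_zero abs_power2) blast
        qed
      qed
    qed
  qed

  have expansion_a: "\<forall>\<^sub>F n in sequentially. \<forall>\<omega>\<in>?D n.
      \<bar>\<Delta> n \<omega> - r2 n \<omega>\<bar> = a n \<omega> * \<bar>K n / (2 * J n) + r1 n \<omega>\<bar>"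
    using expansion b_pos by eventually_elim (simp add: a_def abs_mult)

  have sufficient: "tendsto_in_prob P \<Delta> 0" if "tendsto_in_prob P a 0"
    unfolding tendsto_in_prob_iff_vanishing
  proof (intro allI impI)
    fix \<epsilon> :: real assume "\<epsilon> > 0"
    \<comment> \<open>Off these events the bracket of the expansion is at most \<open>C + 1\<close>,
      so the leading term and \<open>r2\<close> each contribute at most
      \<open>\<epsilon>/2\<close>.\<close>
    let ?R = "\<lambda>n \<omega>. (\<omega> \<notin> ?D n \<or> \<bar>r1 n \<omega> - 0\<bar> > 1) \<or> (\<bar>r2 n \<omega> - 0\<bar> > \<epsilon>/2 \<or> \<bar>a n \<omega> - 0\<bar> > \<epsilon> / (2 * (C + 1)))"
    show "vanishing_event P (\<lambda>n \<omega>. \<epsilon> < \<bar>\<Delta> n \<omega> - 0\<bar>)"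
    proof (rule vanishing_event_mono)
      show "vanishing_event P ?R"
        using \<open>\<epsilon> > 0\<close> C(1)
        by (intro vanishing_event_disj undef tendsto_in_probD r1 r2 that) auto
      show "\<forall>\<^sub>F n in sequentially. \<forall>\<omega>\<in>space (P n). \<epsilon> < \<bar>\<Delta> n \<omega> - 0\<bar> \<longrightarrow> ?R n \<omega>"
        using expansion_a C(2)
      proof eventually_elim
        case (elim n)
        have "\<bar>\<Delta> n \<omega>\<bar> \<le> \<epsilon>" if good: "\<not> ?R n \<omega>" for \<omega>
        proof -
          have "\<bar>K n / (2 * J n)\<bar> \<le> C" using elim(2) C(1) by (simp add: abs_mult)
          then have "\<bar>K n / (2 * J n) + r1 n \<omega>\<bar> \<le> C + 1" using good by linarith
          moreover have "a n \<omega> \<le> \<epsilon> / (2 * (C + 1))" using good by auto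
          ultimately have "a n \<omega> * \<bar>K n / (2 * J n) + r1 n \<omega>\<bar> \<le> \<epsilon> / (2 * (C + 1)) * (C + 1)"
            using C(1) \<open>\<epsilon> > 0\<close> by (intro mult_mono) auto
          also have "\<dots> = \<epsilon>/2" using C(1) by (simp add: field_simps)
          finally have "\<bar>\<Delta> n \<omega> - r2 n \<omega>\<bar> \<le> \<epsilon>/2" using elim(1) good by simp
          moreover have "\<bar>r2 n \<omega>\<bar> \<le> \<epsilon>/2" using good by simp
          ultimately show ?thesis by linarith
        qed
        then show ?case by (metis diff_zero linorder_not_less)
      qed
    qed
  qed

  have necessary: "tendsto_in_prob P a 0"
    if \<Delta>: "tendsto_in_prob P \<Delta> 0"
      and \<delta>: "\<delta> > 0" "liminf (\<lambda>n. ereal (\<bar>K n\<bar> / \<bar>J n\<bar>)) \<ge> ereal \<delta>" for \<delta>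
    unfolding tendsto_in_prob_iff_vanishing
  proof (intro allI impI)
    fix \<epsilon> :: real assume "\<epsilon> > 0"
    \<comment> \<open>A liminf of at least \<open>\<delta>\<close> yields an eventual bound only
      below \<open>\<delta>\<close>; half of it is kept.\<close>
    have "ereal (\<delta>/2) < liminf (\<lambda>n. ereal (\<bar>K n\<bar> / \<bar>J n\<bar>))"
      using \<delta> by (intro less_le_trans[OF _ \<delta>(2)]) simp
    then have K: "\<forall>\<^sub>F n in sequentially. \<delta>/2 < \<bar>K n\<bar> / \<bar>J n\<bar>"
      by (auto dest!: less_LiminfD)
    \<comment> \<open>\<open>K / (2 J)\<close> has modulus at least \<open>\<delta>/4\<close>, so
      \<open>r1\<close> of size at most \<open>\<delta>/8\<close> leaves a bracket of at least
      \<open>\<delta>/8\<close>. Two errors of \<open>\<epsilon> * \<delta>/16\<close> then give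
      \<open>a * \<delta>/8 \<le> \<epsilon> * \<delta>/8\<close>.\<close>
    let ?R = "\<lambda>n \<omega>. (\<omega> \<notin> ?D n \<or> \<bar>r1 n \<omega> - 0\<bar> > \<delta>/8) \<or>
       (\<bar>r2 n \<omega> - 0\<bar> > \<epsilon> * \<delta>/16 \<or> \<bar>\<Delta> n \<omega> - 0\<bar> > \<epsilon> * \<delta>/16)"
    show "vanishing_event P (\<lambda>n \<omega>. \<epsilon> < \<bar>a n \<omega> - 0\<bar>)"
    proof (rule vanishing_event_mono)
      show "vanishing_event P ?R"
        using \<open>\<epsilon> > 0\<close> \<delta>(1)
        by (intro vanishing_event_disj undef tendsto_in_probD r1 r2 \<Delta>) auto
      show "\<forall>\<^sub>F n in sequentially. \<forall>\<omega>\<in>space (P n). \<epsilon> < \<bar>a n \<omega> - 0\<bar> \<longrightarrow> ?R n \<omega>"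
        using expansion_a K b_pos
      proof eventually_elim
        case (elim n)
        have "\<bar>a n \<omega>\<bar> \<le> \<epsilon>" if good: "\<not> ?R n \<omega>" for \<omega>
        proof -
          have a: "a n \<omega> \<ge> 0" using elim(3) by (simp add: a_def)
          have "\<delta>/4 \<le> \<bar>K n / (2 * J n)\<bar>" using elim(2) by (simp add: abs_mult mult.commute)
          then have "\<delta>/8 \<le> \<bar>K n / (2 * J n) + r1 n \<omega>\<bar>" using good by linarith
          then have "a n \<omega> * (\<delta>/8) \<le> a n \<omega> * \<bar>K n / (2 * J n) + r1 n \<omega>\<bar>"
            using a by (intro mult_left_mono)
          also have "\<dots> = \<bar>\<Delta> n \<omega> - r2 n \<omega>\<bar>" using elim(1) good by simp
          also have "\<dots> \<le> \<epsilon> * \<delta>/16 + \<epsilon> * \<delta>/16"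
            using good by (intro order_trans[OF abs_triangle_ineq4] add_mono) auto
          also have "\<dots> = \<epsilon> * (\<delta>/8)" by simp
          finally show ?thesis using a \<delta>(1) by simp
        qed
        then show ?case by (metis diff_zero linorder_not_less)
      qed
    qed
  qed

  have "{\<omega> \<in> space (P n). \<omega> \<notin> ?D n} = space (P n) - ?D n" for n by auto
  then have "(\<lambda>n. outer_measure_of (P n) (space (P n) - ?D n)) \<longlonglongrightarrow> 0"
    using undef by (simp add: vanishing_event_def)
  then show ?thesis
    using r1 r2 expansion sufficient necessary unfolding root_iff by blast
qed

end
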